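(* Let $T$ be a tree of diameter $d$ and let $D$ be a target distribution on $T$ of size $t\ge 1$. Then $\pi(T,D)\le \pi_t(T)-s(D)+1$. Furthermore, if $C$ is a configuration on $T$ of size $|C|\ge \pi_t(T)-s(D)+1$, then for every vertex $v$ with $D(v)>0$, $C$ solves $v$ with cost at most $2^{\mathrm{ecc}_T(v)}$.
   Context: A configuration on a connected graph $G$ is a function $C:V(G)\to\mathbb{N}$ (number of pebbles on each vertex), of size $|C|=\sum_v C(v)$. A pebbling step from a vertex $u$ with $C(u)\ge 2$ to a neighbor $w$ removes two pebbles from $u$ and adds one pebble to $w$. For a vertex $r$, $C$ is $t$-fold $r$-solvable if some sequence of pebbling steps places at least $t$ pebbles on $r$; $\pi_t(G,r)$ is the least $m$ such that every configuration of size $m$ is $t$-fold $r$-solvable, and $\pi_t(G)=\max_r \pi_t(G,r)$. A target distribution is a function $D:V(G)\to\mathbb{N}$, of size $|D|=\sum_v D(v)$; $C$ is $D$-solvable if some sequence of pebbling steps results in at least $D(v)$ pebbles on each vertex $v$ simultaneously, and $\pi(G,D)$ is the least $m$ such that every configuration of size at least $m$ is $D$-solvable. $s(D)$ denotes the number of vertices $v$ with $D(v)>0$. For an $r$-solution $\sigma$ (a sequence of $c$ pebbling steps placing a pebble on $r$), its cost is $c+1$; "$C$ solves $v$ with cost at most $x$" means there is a sequence of pebbling steps from $C$ placing a pebble on $v$ whose cost is at most $x$. $\mathrm{ecc}_T(v)$ is the maximum distance in $T$ from $v$ to another vertex. *)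

theory Defs
  imports "Graph_Theory.Digraph_Component"
begin

text \<open>
  Undirected finite simple graphs are the symmetric digraphs of the locale
  \<open>graph\<close>; every edge is a pair of opposite arcs. The library's \<open>forest\<close> and \<open>tree\<close>
  forbid directed cycles and thus already exclude the back-and-forth walk along
  a single edge. The cycles of the underlying undirected graph are exactly the
  directed cycles of length at least 3. \<open>connected\<close> includes that the
  vertex set is nonempty.
\<close>

definition undirected_tree :: "('a, 'b) pre_digraph \<Rightarrow> bool" where
  "undirected_tree G \<longleftrightarrow>
     graph G \<and> Digraph_Component.connected G \<and>
     \<not> (\<exists>p. pre_digraph.cycle G p \<and> 3 \<le> length p)"

definition graph_dist :: "('a, 'b) pre_digraph \<Rightarrow> 'a \<Rightarrow> 'a \<Rightarrow> nat" where
  "graph_dist G u v = (LEAST n. \<exists>p. pre_digraph.awalk G u p v \<and> length p = n)"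

text \<open>
  The vertex itself is included, at distance 0, so that the eccentricity
  in a one-vertex graph is 0.
\<close>

definition ecc :: "('a, 'b) pre_digraph \<Rightarrow> 'a \<Rightarrow> nat" where
  "ecc G v = Max (graph_dist G v ` verts G)"

definition graph_diameter :: "('a, 'b) pre_digraph \<Rightarrow> nat" where
  "graph_diameter G = Max {graph_dist G u v | u v. u \<in> verts G \<and> v \<in> verts G}"

text \<open>
  Configurations and target distributions are functions on the whole vertex type; all
  notions below depend only on their values on \<open>verts G\<close>.
\<close>

definition conf_size :: "('a, 'b) pre_digraph \<Rightarrow> ('a \<Rightarrow> nat) \<Rightarrow> nat" where
  "conf_size G C = (\<Sum>v\<in>verts G. C v)"

definition pebbling_step :: "('a, 'b) pre_digraph \<Rightarrow> ('a \<Rightarrow> nat) \<Rightarrow> ('a \<Rightarrow> nat) \<Rightarrow> bool" where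
  "pebbling_step G C C' \<longleftrightarrow>
     (\<exists>u w. u \<rightarrow>\<^bsub>G\<^esub> w \<and> 2 \<le> C u \<and> C' = C(u := C u - 2, w := C w + 1))"

definition fold_solvable :: "('a, 'b) pre_digraph \<Rightarrow> nat \<Rightarrow> 'a \<Rightarrow> ('a \<Rightarrow> nat) \<Rightarrow> bool" where
  "fold_solvable G t r C \<longleftrightarrow> (\<exists>C'. (pebbling_step G)\<^sup>*\<^sup>* C C' \<and> t \<le> C' r)"

definition rooted_pebbling_number :: "('a, 'b) pre_digraph \<Rightarrow> nat \<Rightarrow> 'a \<Rightarrow> nat" where
  "rooted_pebbling_number G t r =
     (LEAST m. \<forall>C. conf_size G C = m \<longrightarrow> fold_solvable G t r C)"

definition fold_pebbling_number :: "('a, 'b) pre_digraph \<Rightarrow> nat \<Rightarrow> nat" where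
  "fold_pebbling_number G t = Max (rooted_pebbling_number G t ` verts G)"

definition target_solvable ::
    "('a, 'b) pre_digraph \<Rightarrow> ('a \<Rightarrow> nat) \<Rightarrow> ('a \<Rightarrow> nat) \<Rightarrow> bool" where
  "target_solvable G D C \<longleftrightarrow>
     (\<exists>C'. (pebbling_step G)\<^sup>*\<^sup>* C C' \<and> (\<forall>v\<in>verts G. D v \<le> C' v))"

definition target_pebbling_number :: "('a, 'b) pre_digraph \<Rightarrow> ('a \<Rightarrow> nat) \<Rightarrow> nat" where
  "target_pebbling_number G D =
     (LEAST m. \<forall>C. m \<le> conf_size G C \<longrightarrow> target_solvable G D C)"

definition support_size :: "('a, 'b) pre_digraph \<Rightarrow> ('a \<Rightarrow> nat) \<Rightarrow> nat" where
  "support_size G D = card {v \<in> verts G. 0 < D v}"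

text \<open>A solution with \<open>c\<close> pebbling steps has cost \<open>c + 1\<close>.\<close>

definition solves_with_cost_at_most ::
    "('a, 'b) pre_digraph \<Rightarrow> ('a \<Rightarrow> nat) \<Rightarrow> 'a \<Rightarrow> nat \<Rightarrow> bool" where
  "solves_with_cost_at_most G C v x \<longleftrightarrow>
     (\<exists>c C'. (pebbling_step G ^^ c) C C' \<and> 1 \<le> C' v \<and> c + 1 \<le> x)"

end

theory Submission
  imports Defs
begin

text \<open>
  Root the tree at \<open>r\<close> and let \<open>h\<^sub>r(u)\<close> be the height of the subtree hanging from \<open>u\<close>. The quantity
  \<open>w(r) = (\<Sum>u \<noteq> r. 2 ^ h\<^sub>r(u))\<close> governs everything.

  Upper bound: cut the configuration into pieces, each of which can be collected into a single
  pebble on some vertex \<open>u\<close> at cost at most \<open>2 ^ h\<^sub>r(u)\<close>. Two pieces collected on the same \<open>u \<noteq> r\<close>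
  merge into one on the parent of \<open>u\<close>, so in a shortest list of pieces every \<open>u \<noteq> r\<close> occurs at most
  once; more than \<open>w(r)\<close> pebbles therefore yield a piece on \<open>r\<close>, of cost at most \<open>2 ^ ecc(r)\<close>.
  Empty leaves carry no piece, so each of them lowers the threshold by one.

  Lower bound: one pebble on every \<open>u \<noteq> r\<close> and \<open>t - 1\<close> pebbles on \<open>r\<close> do not allow \<open>t\<close> pebbles on \<open>r\<close>.
  Replacing a pebble by two pebbles on a child preserves this, and doing so down to deepest
  leaves gives an unsolvable configuration of size \<open>w(r) + (t - 1) 2 ^ ecc(r)\<close>.

  Moving the root shows that \<open>w\<close> is maximal at a vertex of eccentricity \<open>d\<close>, hence
  \<open>\<pi>\<^sub>t(T) \<ge> w(v) + (t - 1) 2 ^ d + 1\<close> for all \<open>v\<close>. The targets are now served one after another. A target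
  costs at most \<open>2 ^ d\<close>, and less than \<open>2 ^ d\<close> if it already carries a pebble or has eccentricity
  below \<open>d\<close>; when neither helps and no target is required twice, all targets are empty leaves, and
  these make up for the missing \<open>s(D) - 1\<close> pebbles.
\<close>

section \<open>Distances in trees\<close>

unbundle no funcset_syntax

locale tree_graph = graph +
  assumes undirected_tree: "undirected_tree G"
begin

abbreviation gdist :: "'a \<Rightarrow> 'a \<Rightarrow> nat" where
  "gdist \<equiv> graph_dist G"

lemma adj_sym: "u \<rightarrow> w \<Longrightarrow> w \<rightarrow> u"
  using sym_arcs by (auto simp: symmetric_def sym_def)

lemma adj_neq: "u \<rightarrow> w \<Longrightarrow> u \<noteq> w"
  using no_loops by (auto simp: arcs_ends_conv)

lemma awalk_exists:
  assumes "u \<in> verts G" "v \<in> verts G"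
  obtains p where "awalk u p v"
proof -
  have "u \<rightarrow>\<^sup>*\<^bsub>mk_symmetric G\<^esub> v"
    using undirected_tree assms
    by (auto simp: undirected_tree_def Digraph_Component.connected_def strongly_connected_def)
  then show thesis using that reachable_mk_symmetric_eq[OF sym_arcs] by (auto simp: reachable_awalk)
qed

lemma shortest_awalk:
  assumes "u \<in> verts G" "v \<in> verts G"
  obtains p where "awalk u p v" "length p = gdist u v"
proof -
  obtain q where "awalk u q v" using awalk_exists[OF assms] .
  then have "\<exists>n p. awalk u p v \<and> length p = n" by blast
  from LeastI_ex[OF this] show thesis using that unfolding graph_dist_def by blast
qed

lemma gdist_le: "awalk u p v \<Longrightarrow> gdist u v \<le> length p"
  unfolding graph_dist_def by (rule Least_le) blast

lemma gdist_refl [simp]: "u \<in> verts G \<Longrightarrow> gdist u u = 0"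
  using gdist_le[of u "[]" u] by (simp add: awalk_Nil_iff)

lemma gdist_eq_0_iff: "u \<in> verts G \<Longrightarrow> v \<in> verts G \<Longrightarrow> gdist u v = 0 \<longleftrightarrow> u = v"
  by (rule shortest_awalk[of u v]) (auto simp: awalk_Nil_iff)

lemma gdist_triangle:
  assumes "u \<in> verts G" "v \<in> verts G" "w \<in> verts G"
  shows "gdist u w \<le> gdist u v + gdist v w"
proof -
  obtain p where p: "awalk u p v" "length p = gdist u v" using shortest_awalk[OF assms(1,2)] .
  obtain q where q: "awalk v q w" "length q = gdist v w" using shortest_awalk[OF assms(2,3)] .
  show ?thesis using gdist_le[OF awalk_appendI[OF p(1) q(1)]] p(2) q(2) by simp
qed

lemma adj_awalk: "u \<rightarrow> w \<Longrightarrow> \<exists>e. awalk u [e] w"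
  by (auto simp: arcs_ends_conv awalk_simps)

lemma awalk_rev: "awalk u p v \<Longrightarrow> \<exists>q. awalk v q u \<and> length q = length p"
proof (induction p arbitrary: u)
  case Nil
  then show ?case by (auto simp: awalk_Nil_iff)
next
  case (Cons e p)
  then obtain q where q: "awalk v q (head G e)" "length q = length p"
    by (auto simp: awalk_Cons_iff)
  have "u \<rightarrow> head G e" using Cons.prems by (auto simp: awalk_Cons_iff arcs_ends_conv)
  then obtain e' where "awalk (head G e) [e'] u" using adj_sym adj_awalk by blast
  then have "awalk v (q @ [e']) u" using q(1) awalk_appendI by blast
  then show ?case using q(2) by (intro exI[of _ "q @ [e']"]) simp
qed

lemma gdist_sym:
  assumes "u \<in> verts G" "v \<in> verts G"
  shows "gdist u v = gdist v u"
proof -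
  have "gdist y x \<le> gdist x y" if xy: "x \<in> verts G" "y \<in> verts G" for x y
  proof -
    obtain p where p: "awalk x p y" "length p = gdist x y" using shortest_awalk[OF xy] .
    then obtain q where "awalk y q x" "length q = length p" using awalk_rev by blast
    then show ?thesis using gdist_le[of y q x] p by simp
  qed
  then show ?thesis using assms by (simp add: antisym)
qed

lemma gdist_adj: "u \<rightarrow> w \<Longrightarrow> gdist u w \<le> 1"
proof -
  assume "u \<rightarrow> w"
  then obtain e where "awalk u [e] w" using adj_awalk by blast
  from gdist_le[OF this] show ?thesis by simp
qed

lemma gdist_adj_le:
  assumes "r \<in> verts G" "u \<rightarrow> w"
  shows "gdist r w \<le> Suc (gdist r u)"
proof -
  have "u \<in> verts G" "w \<in> verts G" using assms(2) adj_in_verts by auto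
  then show ?thesis using gdist_triangle[of r u w] gdist_adj[OF assms(2)] assms(1) by simp
qed

lemma gdist_pred:
  assumes "u \<in> verts G" "v \<in> verts G" "gdist u v = Suc n"
  obtains w where "w \<rightarrow> v" "gdist u w = n"
proof -
  obtain p where p: "awalk u p v" "length p = gdist u v" using shortest_awalk[OF assms(1,2)] .
  then obtain es e where pe: "p = es @ [e]" "length es = n"
    using assms(3) by (cases p rule: rev_cases) auto
  then have w: "awalk u es (awlast u es)" "e \<in> arcs G" "tail G e = awlast u es" "head G e = v"
    using p(1) by (auto simp: awalk_simps)
  then have adj: "awlast u es \<rightarrow> v" by (force simp: arcs_ends_conv)
  moreover have "gdist u (awlast u es) = n"
    using gdist_le[OF w(1)] pe(2) gdist_adj_le[OF assms(1) adj] assms(3) by simp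
  ultimately show thesis using that by blast
qed

lemma shortest_awalk_verts:
  assumes "awalk u p v" "length p = gdist u v" "x \<in> set (awalk_verts u p)"
  shows "x = u \<or> gdist x v < gdist u v" "x = v \<or> gdist u x < gdist u v"
proof -
  obtain q s where qs: "p = q @ s" "awalk u q x" "awalk x s v"
    using awalk_decomp[OF assms(1,3)] by blast
  show "x = u \<or> gdist x v < gdist u v"
    using qs gdist_le[OF qs(3)] assms(2) by (cases q) (auto simp: awalk_Nil_iff)
  show "x = v \<or> gdist u x < gdist u v"
    using qs gdist_le[OF qs(2)] assms(2) by (cases s) (auto simp: awalk_Nil_iff)
qed

text \<open>Shortened to a path avoiding \<open>u\<close>, such a walk would close up through
  \<open>u\<close> to a cycle. Since \<open>w\<close> and \<open>w'\<close> differ, the path has at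
  least one arc, so the cycle has length at least 3.\<close>

lemma no_detour:
  assumes "u \<rightarrow> w" "w' \<rightarrow> u" "w \<noteq> w'" "awalk w p w'"
  shows "u \<in> set (awalk_verts w p)"
proof (rule ccontr)
  assume u: "u \<notin> set (awalk_verts w p)"
  define q where "q = awalk_to_apath p"
  have q: "apath w q w'" "set q \<subseteq> set p"
    unfolding q_def using assms(4) apath_awalk_to_apath awalk_to_apath_subset by blast+
  have qw: "awalk w q w'" "distinct (awalk_verts w q)" using q(1) by (auto simp: apath_def)
  have uq: "u \<notin> set (awalk_verts w q)"
    using u q(2) unfolding set_awalk_verts[OF qw(1)] set_awalk_verts[OF assms(4)] by auto
  obtain e where e: "e \<in> arcs G" "tail G e = u" "head G e = w"
    using assms(1) by (auto simp: arcs_ends_conv)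
  obtain f where f: "f \<in> arcs G" "tail G f = w'" "head G f = u"
    using assms(2) by (auto simp: arcs_ends_conv)
  have fw: "awalk w' [f] u" using f by (auto simp: awalk_simps)
  have qf: "awalk w (q @ [f]) u" using awalk_appendI[OF qw(1) fw] .
  have "awalk_verts w (q @ [f]) = awalk_verts w q @ [u]"
    using awalk_verts_append[OF qf] f by simp
  then have "distinct (awalk_verts w (q @ [f]))" using uq qw(2) by simp
  moreover have "awalk u (e # q @ [f]) u"
    using e qf by (simp only: awalk_Cons_iff)
  ultimately have "cycle (e # q @ [f])"
    unfolding cycle_def using e by (intro exI[of _ u]) auto
  moreover have "q \<noteq> []" using qw(1) assms(3) by (auto simp: awalk_Nil_iff)
  then have "3 \<le> length (e # q @ [f])" by (cases q) auto
  ultimately show False using undirected_tree by (auto simp: undirected_tree_def)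
qed

text \<open>Shortest walks from \<open>w\<close> to \<open>r\<close> and from \<open>r\<close> to
  \<open>w'\<close> join to a walk that must pass through \<open>u\<close>, yet its vertices other
  than \<open>w\<close> and \<open>w'\<close> are strictly closer to \<open>r\<close> than
  \<open>u\<close>. Admitting equal distances is what later excludes edges within one level.\<close>

lemma closer_neighbour_unique:
  assumes r: "r \<in> verts G" and adj: "u \<rightarrow> w" "u \<rightarrow> w'"
    and le: "gdist r w \<le> gdist r u" "gdist r w' \<le> gdist r u"
  shows "w = w'"
proof (rule ccontr)
  assume neq: "w \<noteq> w'"
  have V: "u \<in> verts G" "w \<in> verts G" "w' \<in> verts G" using adj adj_in_verts by auto
  obtain p where p: "awalk w p r" "length p = gdist w r" using shortest_awalk[OF V(2) r] .
  obtain q where q: "awalk r q w'" "length q = gdist r w'" using shortest_awalk[OF r V(3)] .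
  have "u \<in> set (awalk_verts w (p @ q))"
    using no_detour[OF adj(1) adj_sym[OF adj(2)] neq] awalk_appendI[OF p(1) q(1)] by blast
  then consider "u \<in> set (awalk_verts w p)" | "u \<in> set (awalk_verts r q)"
    using set_awalk_verts_append[OF p(1) q(1)] by auto
  then show False
  proof cases
    case 1
    then show False using shortest_awalk_verts(1)[OF p 1] adj_neq[OF adj(1)] le
      gdist_sym[of r u] gdist_sym[of r w] r V by simp
  next
    case 2
    then show False using shortest_awalk_verts(2)[OF q 2] adj_neq[OF adj(2)] le by simp
  qed
qed

text \<open>If both ends had the same positive distance, \<open>w\<close> and the predecessor of
  \<open>u\<close> on a shortest walk would be two different neighbours of \<open>u\<close>, neither
  further from \<open>r\<close> than \<open>u\<close>.\<close>

lemma adj_gdist_cases: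
  assumes r: "r \<in> verts G" and adj: "u \<rightarrow> w"
  obtains "gdist r u = Suc (gdist r w)" | "gdist r w = Suc (gdist r u)"
proof -
  have V: "u \<in> verts G" "w \<in> verts G" using adj adj_in_verts by auto
  have "gdist r u \<noteq> gdist r w"
  proof
    assume eq: "gdist r u = gdist r w"
    show False
    proof (cases "gdist r u")
      case 0
      then show False using eq gdist_eq_0_iff[OF r] V adj_neq[OF adj] by auto
    next
      case (Suc n)
      then obtain z where z: "z \<rightarrow> u" "gdist r z = n" using gdist_pred r V by blast
      then show False
        using closer_neighbour_unique[OF r adj_sym[OF z(1)] adj] Suc eq by auto
    qed
  qed
  then show thesis
    using that gdist_adj_le[OF r adj] gdist_adj_le[OF r adj_sym[OF adj]] by linarith
qed

end

section \<open>Subtree heights and moving the root\<close>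

context tree_graph
begin

text \<open>The subtree hanging from \<open>u\<close> when the tree is rooted at \<open>r\<close>.\<close>

definition below :: "'a \<Rightarrow> 'a \<Rightarrow> 'a set" where
  "below r u = {z \<in> verts G. gdist r z = gdist r u + gdist u z}"

definition ht :: "'a \<Rightarrow> 'a \<Rightarrow> nat" where
  "ht r u = Max (gdist u ` below r u)"

text \<open>In a maximum path partition towards \<open>r\<close>, a path of length \<open>a\<close>
  contributes \<open>1 + 2 + ... + 2 ^ (a - 1)\<close>. So this is Chung's sum of
  \<open>2 ^ a - 1\<close> over the paths, one less than the pebbling number at
  \<open>r\<close>.\<close>

definition weight :: "'a \<Rightarrow> nat" where
  "weight r = (\<Sum>u\<in>verts G - {r}. 2 ^ ht r u)"

lemma below_subset: "below r u \<subseteq> verts G"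
  by (auto simp: below_def)

lemma finite_below [simp]: "finite (below r u)"
  using below_subset finite_verts by (rule finite_subset)

lemma ht_ge: "z \<in> below r u \<Longrightarrow> gdist u z \<le> ht r u"
  by (simp add: ht_def)

lemma ht_attained:
  assumes "u \<in> verts G"
  obtains z where "z \<in> below r u" "gdist u z = ht r u"
proof -
  have "u \<in> below r u" using assms by (simp add: below_def)
  then have "Max (gdist u ` below r u) \<in> gdist u ` below r u" by (intro Max_in) auto
  then show thesis using that by (auto simp: ht_def)
qed

lemma ht_root: "r \<in> verts G \<Longrightarrow> ht r r = ecc G r"
proof -
  assume "r \<in> verts G"
  then have "below r r = verts G" by (auto simp: below_def)
  then show ?thesis by (simp add: ht_def ecc_def)
qed

text \<open>A deepest vertex below \<open>x\<close> also lies below \<open>u\<close>, one step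
  further away: the triangle inequality through \<open>u\<close> leaves no slack.\<close>

lemma ht_child:
  assumes r: "r \<in> verts G" and adj: "u \<rightarrow> x" and d: "gdist r x = Suc (gdist r u)"
  shows "Suc (ht r x) \<le> ht r u"
proof -
  have V: "u \<in> verts G" "x \<in> verts G" using adj adj_in_verts by auto
  obtain z where z: "z \<in> below r x" "gdist x z = ht r x" using ht_attained[OF V(2)] .
  have zV: "z \<in> verts G" and rz: "gdist r z = gdist r x + gdist x z"
    using z(1) by (auto simp: below_def)
  have "gdist u z \<le> 1 + gdist x z"
    using gdist_triangle[OF V zV] gdist_adj[OF adj] by simp
  moreover have "gdist r z \<le> gdist r u + gdist u z" using gdist_triangle[OF r V(1) zV] .
  ultimately have "gdist u z = Suc (gdist x z)" "gdist r z = gdist r u + gdist u z"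
    using rz d by auto
  then show ?thesis using ht_ge[of z r u] zV z(2) by (simp add: below_def)
qed

text \<open>The assumption puts \<open>r'\<close> between \<open>r\<close> and \<open>u\<close>, so
  moving the root from \<open>r\<close> to \<open>r'\<close> does not change which side of
  \<open>u\<close> faces the root.\<close>

lemma below_closer_root:
  assumes adj: "r \<rightarrow> r'" and u: "u \<in> verts G" "u \<noteq> r'" and d: "gdist u r = Suc (gdist u r')"
  shows "below r u = below r' u"
proof -
  have V: "r \<in> verts G" "r' \<in> verts G" using adj adj_in_verts by auto
  have ru: "gdist r u = Suc (gdist r' u)" using d gdist_sym u V by simp
  have "gdist r z = gdist r u + gdist u z \<longleftrightarrow> gdist r' z = gdist r' u + gdist u z"
    if z: "z \<in> verts G" for z
  proof
    assume "gdist r z = gdist r u + gdist u z"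
    moreover have "gdist r z \<le> 1 + gdist r' z"
      using gdist_triangle[OF V z] gdist_adj[OF adj] by simp
    ultimately show "gdist r' z = gdist r' u + gdist u z"
      using gdist_triangle[OF V(2) u(1) z] ru by simp
  next
    assume r'z: "gdist r' z = gdist r' u + gdist u z"
    from z adj show "gdist r z = gdist r u + gdist u z"
    proof (cases rule: adj_gdist_cases)
      case 1
      then show ?thesis using r'z ru gdist_sym z V by simp
    next
      case 2
      \<comment> \<open>Here both \<open>r\<close> and the neighbour \<open>b\<close> of
        \<open>r'\<close> towards \<open>u\<close> would lead from \<open>r'\<close> towards
        \<open>z\<close>, so \<open>r = b\<close>. But \<open>r\<close> is further from
        \<open>u\<close> than \<open>r'\<close>, and \<open>b\<close> is nearer.\<close>
      obtain m where m: "gdist u r' = Suc m" using u gdist_eq_0_iff V(2) by (cases "gdist u r'") auto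
      obtain b where b: "b \<rightarrow> r'" "gdist u b = m" using gdist_pred[OF u(1) V(2) m] .
      have bV: "b \<in> verts G" using b(1) adj_in_verts by auto
      have "gdist z b \<le> gdist z r'"
        using gdist_triangle[OF z u(1) bV] b(2) m r'z gdist_sym z u V by simp
      then have "r = b"
        using closer_neighbour_unique[OF z adj_sym[OF adj] adj_sym[OF b(1)]] 2 by simp
      then show ?thesis using b(2) m d by simp
    qed
  qed
  then show ?thesis by (auto simp: below_def)
qed

lemma ht_swap_root:
  assumes adj: "r \<rightarrow> r'" and u: "u \<in> verts G" "u \<noteq> r" "u \<noteq> r'"
  shows "ht r u = ht r' u"
  using u(1) adj
proof (cases rule: adj_gdist_cases)
  case 1
  then show ?thesis using below_closer_root[OF adj u(1,3)] by (simp add: ht_def)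
next
  case 2
  then show ?thesis using below_closer_root[OF adj_sym[OF adj] u(1,2)] by (simp add: ht_def)
qed

text \<open>All terms agree except that of \<open>r'\<close> in \<open>weight r\<close> and that of
  \<open>r\<close> in \<open>weight r'\<close>.\<close>

lemma weight_swap_root:
  assumes adj: "r \<rightarrow> r'"
  shows "weight r + 2 ^ ht r' r = weight r' + 2 ^ ht r r'"
proof -
  have V: "r \<in> verts G" "r' \<in> verts G" using adj adj_in_verts by auto
  have *: "weight x = 2 ^ ht x y + (\<Sum>u\<in>verts G - {r, r'}. 2 ^ ht x u)"
    if "(x, y) = (r, r') \<or> (x, y) = (r', r)" for x y
  proof -
    have eq: "verts G - {x} = insert y (verts G - {r, r'})"
      using that V adj_neq[OF adj] by auto
    show ?thesis unfolding weight_def eq using that by (subst sum.insert) auto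
  qed
  have "(\<Sum>u\<in>verts G - {r, r'}. 2 ^ ht r u) = (\<Sum>u\<in>verts G - {r, r'}. 2 ^ ht r' u :: nat)"
    using ht_swap_root[OF adj] by (intro sum.cong) auto
  then show ?thesis using *[of r r'] *[of r' r] by simp
qed

text \<open>The root travels from \<open>v\<close> to \<open>p\<close> edge by edge; none of these
  edges meets \<open>z\<close>, so its height never changes.\<close>

lemma ht_from_parent:
  assumes "v \<in> verts G" and adj: "p \<rightarrow> z" and "gdist v z = Suc (gdist v p)"
  shows "ht v z = ht p z"
  using assms(1,3)
proof (induction "gdist v p" arbitrary: v)
  case 0
  then show ?case using gdist_eq_0_iff[of v p] adj adj_in_verts by auto
next
  case (Suc n)
  have V: "p \<in> verts G" "z \<in> verts G" using adj adj_in_verts by auto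
  have "gdist p v = Suc n" using Suc.hyps(2) gdist_sym[OF Suc.prems(1) V(1)] by simp
  then obtain v' where v': "v' \<rightarrow> v" "gdist p v' = n" using gdist_pred V Suc.prems(1) by blast
  have v'V: "v' \<in> verts G" using v'(1) adj_in_verts by auto
  have pn: "gdist v' p = n" using v'(2) gdist_sym v'V V by simp
  have "gdist v' z \<le> Suc n" using gdist_adj_le[OF v'V adj] pn by simp
  moreover have "gdist v z \<le> Suc (gdist v' z)"
    using gdist_triangle[OF Suc.prems(1) v'V V(2)] gdist_adj[OF adj_sym[OF v'(1)]] by simp
  ultimately have v'z: "gdist v' z = Suc n" using Suc.prems(2) Suc.hyps(2) by simp
  have "ht v' z = ht p z" using Suc.hyps(1)[of v'] pn v'V v'z by simp
  moreover have "z \<noteq> v'" using v'z gdist_refl[OF V(2)] by auto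
  moreover have "z \<noteq> v" using Suc.prems(2) gdist_refl[OF V(2)] by auto
  moreover have "ht v' z = ht v z" if "z \<noteq> v'" "z \<noteq> v"
    using ht_swap_root[OF v'(1) V(2) that] .
  ultimately show ?case by simp
qed

text \<open>Moving the root from \<open>p\<close> to \<open>z\<close> trades the term
  \<open>2 ^ ht v z\<close> for \<open>2 ^ ht z p\<close>, and \<open>2 ^ ht v p\<close> is at least
  twice \<open>2 ^ ht v z\<close>. So the estimate passes from \<open>p\<close> to \<open>z\<close>
  with \<open>2 ^ ht z p\<close> to spare; \<open>weight_le_peripheral\<close> lives on this
  surplus.\<close>

lemma weight_step:
  assumes v: "v \<in> verts G" and adj: "p \<rightarrow> z" and d: "gdist v z = Suc (gdist v p)"
    and le: "weight v + 2 ^ ht v p \<le> weight p + 2 ^ ecc G v"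
  shows "weight v + 2 ^ ht v z + 2 ^ ht z p \<le> weight z + 2 ^ ecc G v"
proof -
  have "(2::nat) ^ Suc (ht v z) \<le> 2 ^ ht v p"
    using ht_child[OF v adj d] by (intro power_increasing) auto
  then show ?thesis using weight_swap_root[OF adj] ht_from_parent[OF v adj d] le by simp
qed

text \<open>Equality holds at \<open>z = v\<close>, where the height is the eccentricity; each
  further step discards the surplus of \<open>weight_step\<close>.\<close>

lemma weight_le_far:
  assumes v: "v \<in> verts G" and "z \<in> verts G"
  shows "weight v + 2 ^ ht v z \<le> weight z + 2 ^ ecc G v"
  using assms(2)
proof (induction "gdist v z" arbitrary: z)
  case 0
  then show ?case using gdist_eq_0_iff[of v z] v by (auto simp: ht_root)
next
  case (Suc n)
  obtain p where p: "p \<rightarrow> z" "gdist v p = n"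
    using gdist_pred[OF v Suc.prems] Suc.hyps(2) by metis
  then have "weight v + 2 ^ ht v p \<le> weight p + 2 ^ ecc G v"
    using Suc.hyps(1)[of p] adj_in_verts by auto
  from weight_step[OF v p(1) _ this] show ?case using Suc.hyps(2) p(2) by simp
qed

section \<open>Diameter and vertices of maximal eccentricity\<close>

lemma gdist_le_diameter:
  "u \<in> verts G \<Longrightarrow> v \<in> verts G \<Longrightarrow> gdist u v \<le> graph_diameter G"
proof -
  assume V: "u \<in> verts G" "v \<in> verts G"
  have "{gdist u v |u v. u \<in> verts G \<and> v \<in> verts G} = (\<lambda>(u, v). gdist u v) ` (verts G \<times> verts G)"
    by auto
  then have "finite {gdist u v |u v. u \<in> verts G \<and> v \<in> verts G}" by simp
  then show ?thesis unfolding graph_diameter_def using V by (intro Max_ge) auto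
qed

lemma ecc_attained:
  assumes "v \<in> verts G"
  obtains x where "x \<in> verts G" "gdist v x = ecc G v"
proof -
  have "ecc G v \<in> gdist v ` verts G" unfolding ecc_def using assms by (intro Max_in) auto
  then show thesis using that by auto
qed

lemma gdist_le_ecc: "x \<in> verts G \<Longrightarrow> gdist v x \<le> ecc G v"
  by (simp add: ecc_def)

lemma ecc_le_diameter: "v \<in> verts G \<Longrightarrow> ecc G v \<le> graph_diameter G"
  by (metis ecc_attained gdist_le_diameter)

lemma verts_nonempty: "verts G \<noteq> {}"
  using undirected_tree
  by (auto simp: undirected_tree_def Digraph_Component.connected_def strongly_connected_def)

lemma diameter_attained:
  obtains y where "y \<in> verts G" "ecc G y = graph_diameter G"
proof -
  let ?S = "{gdist u v |u v. u \<in> verts G \<and> v \<in> verts G}"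
  have "?S = (\<lambda>(u, v). gdist u v) ` (verts G \<times> verts G)" by auto
  then have "finite ?S" by simp
  moreover have "?S \<noteq> {}" using verts_nonempty by auto
  ultimately have "graph_diameter G \<in> ?S" unfolding graph_diameter_def by (rule Max_in)
  then obtain u v where uv: "graph_diameter G = gdist u v" "u \<in> verts G" "v \<in> verts G" by auto
  have "ecc G u = graph_diameter G"
    using gdist_le_ecc[OF uv(3), of u] ecc_le_diameter[OF uv(2)] uv(1) by simp
  then show thesis using that uv(2) by blast
qed

text \<open>A neighbour further away from \<open>x\<close> would exceed the diameter.\<close>

lemma diametral_neighbour_closer:
  assumes "x \<in> verts G" "u \<rightarrow> c" "gdist u x = graph_diameter G"
  shows "gdist x u = Suc (gdist x c)"
  using assms(1,2)
proof (cases rule: adj_gdist_cases)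
  case 2
  have "u \<in> verts G" "c \<in> verts G" using assms(2) adj_in_verts by auto
  then show ?thesis
    using 2 gdist_le_diameter[OF assms(1), of c] gdist_sym[of u x] assms by simp
qed

text \<open>Such a vertex is a leaf or alone: otherwise its neighbour \<open>a\<close> towards
  \<open>r\<close> and its neighbour \<open>b\<close> towards a deepest vertex below it would both
  lie towards a vertex at distance \<open>d\<close>, hence coincide.\<close>

lemma ht_peripheral:
  assumes r: "r \<in> verts G" and u: "u \<in> verts G" "u \<noteq> r" and e: "ecc G u = graph_diameter G"
  shows "ht r u = 0"
proof (rule ccontr)
  assume "ht r u \<noteq> 0"
  then obtain n where n: "ht r u = Suc n" by (cases "ht r u") auto
  obtain z where z: "z \<in> below r u" "gdist u z = ht r u" using ht_attained[OF u(1)] .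
  then have zV: "z \<in> verts G" and rz: "gdist r z = gdist r u + gdist u z" by (auto simp: below_def)
  obtain x where x: "x \<in> verts G" "gdist u x = graph_diameter G" using ecc_attained[OF u(1)] e by metis
  obtain b where b: "b \<rightarrow> u" "gdist z b = n"
    using gdist_pred[OF zV u(1)] gdist_sym[OF zV u(1)] z(2) n by metis
  obtain m where m: "gdist r u = Suc m" using gdist_eq_0_iff[OF r u(1)] u(2) by (cases "gdist r u") auto
  obtain a where a: "a \<rightarrow> u" "gdist r a = m" using gdist_pred[OF r u(1) m] .
  have V: "a \<in> verts G" "b \<in> verts G" using a(1) b(1) adj_in_verts by auto
  have "a = b"
    using closer_neighbour_unique[OF x(1) adj_sym[OF a(1)] adj_sym[OF b(1)]]
      diametral_neighbour_closer[OF x(1) adj_sym[OF a(1)] x(2)]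
      diametral_neighbour_closer[OF x(1) adj_sym[OF b(1)] x(2)] by simp
  then have "gdist r z \<le> m + n"
    using gdist_triangle[OF r V(2) zV] a(2) b(2) gdist_sym[OF zV V(2)] by simp
  then show False using rz m n z(2) by simp
qed

lemma weight_le_peripheral:
  assumes v: "v \<in> verts G" "ecc G v < graph_diameter G"
    and y: "y \<in> verts G" "ecc G y = graph_diameter G"
  shows "weight v \<le> weight y"
proof -
  obtain n where n: "gdist v y = Suc n"
    using gdist_eq_0_iff[OF v(1) y(1)] v(2) y(2) by (cases "gdist v y") auto
  obtain p where p: "p \<rightarrow> y" "gdist v p = n" using gdist_pred[OF v(1) y(1) n] .
  have pV: "p \<in> verts G" using p(1) adj_in_verts by auto
  obtain x where x: "x \<in> verts G" "gdist y x = graph_diameter G" using ecc_attained[OF y(1)] y(2) by metis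
  \<comment> \<open>Seen from \<open>y\<close>, the far vertex \<open>x\<close> hangs below
    \<open>p\<close>, so the height of \<open>p\<close> is at least \<open>d - 1\<close> and thus at
    least \<open>ecc G v\<close>.\<close>
  have yx: "gdist y x = Suc (gdist p x)"
    using diametral_neighbour_closer[OF x(1) adj_sym[OF p(1)] x(2)] gdist_sym x(1) y(1) pV by simp
  then have "gdist y x = gdist y p + gdist p x"
    using gdist_triangle[OF y(1) pV x(1)] gdist_adj[OF adj_sym[OF p(1)]] by simp
  then have "gdist p x \<le> ht y p" using x(1) by (intro ht_ge) (simp add: below_def)
  \<comment> \<open>The last step onto \<open>y\<close> alone gains \<open>2 ^ (d - 1)\<close>, more than the path from \<open>v\<close> can lose.\<close>
  then have "ecc G v \<le> ht y p" using yx x(2) v(2) by simp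
  then have "(2::nat) ^ ecc G v \<le> 2 ^ ht y p" by (intro power_increasing) auto
  moreover have "weight v + 2 ^ ht v y + 2 ^ ht y p \<le> weight y + 2 ^ ecc G v"
    using weight_step[OF v(1) p(1) _ weight_le_far[OF v(1) pV]] n p(2) by simp
  ultimately show ?thesis by linarith
qed

end

section \<open>Collecting a pebble cheaply\<close>

definition pebble :: "'a \<Rightarrow> 'a \<Rightarrow> nat" where
  "pebble v = (\<lambda>x. if x = v then 1 else 0)"

text \<open>Every step loses one pebble, so all pebbles of \<open>c\<close> are used up and the cost is \<open>conf_size G c\<close>.\<close>

definition collects :: "('a, 'b) pre_digraph \<Rightarrow> ('a \<Rightarrow> nat) \<Rightarrow> 'a \<Rightarrow> bool" where
  "collects G c v \<longleftrightarrow> (\<exists>n. conf_size G c = Suc n \<and> (pebbling_step G ^^ n) c (pebble v))"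

lemma conf_size_add: "conf_size G (\<lambda>x. C x + R x) = conf_size G C + conf_size G R"
  by (simp add: conf_size_def sum.distrib)

lemma pebbling_step_add:
  "pebbling_step G C C' \<Longrightarrow> pebbling_step G (\<lambda>x. C x + R x) (\<lambda>x. C' x + R x)"
  unfolding pebbling_step_def by (elim exE conjE, intro exI conjI) auto

lemma pebbling_relpow_add:
  "(pebbling_step G ^^ n) C C' \<Longrightarrow> (pebbling_step G ^^ n) (\<lambda>x. C x + R x) (\<lambda>x. C' x + R x)"
proof (induction n arbitrary: C')
  case (Suc n)
  then obtain C1 where "(pebbling_step G ^^ n) C C1" "pebbling_step G C1 C'" by auto
  then show ?case using Suc.IH pebbling_step_add by (blast intro: relpowp_Suc_I)
qed simp

lemma pebbling_rtranclp_add: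
  "(pebbling_step G)\<^sup>*\<^sup>* C C' \<Longrightarrow> (pebbling_step G)\<^sup>*\<^sup>* (\<lambda>x. C x + R x) (\<lambda>x. C' x + R x)"
  by (metis pebbling_relpow_add rtranclp_imp_relpowp relpowp_imp_rtranclp)

lemma (in fin_digraph) conf_size_pebble: "v \<in> verts G \<Longrightarrow> conf_size G (pebble v) = 1"
  by (simp add: conf_size_def pebble_def)

context tree_graph
begin

lemma collects_pebble: "v \<in> verts G \<Longrightarrow> collects G (pebble v) v"
  by (simp add: collects_def conf_size_pebble)

text \<open>Collecting both parts on \<open>u\<close> and moving on takes \<open>n + m + 1\<close>
  steps for \<open>n + m + 2\<close> pebbles, so again nothing is left over.\<close>

lemma collects_merge:
  assumes "collects G c u" "collects G c' u" and adj: "u \<rightarrow> w"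
  shows "collects G (\<lambda>x. c x + c' x) w"
proof -
  obtain n where n: "conf_size G c = Suc n" "(pebbling_step G ^^ n) c (pebble u)"
    using assms(1) by (auto simp: collects_def)
  obtain m where m: "conf_size G c' = Suc m" "(pebbling_step G ^^ m) c' (pebble u)"
    using assms(2) by (auto simp: collects_def)
  have "(pebbling_step G ^^ n) (\<lambda>x. c x + c' x) (\<lambda>x. c' x + pebble u x)"
    using pebbling_relpow_add[OF n(2), of c'] by (simp add: add.commute)
  moreover have "(pebbling_step G ^^ m) (\<lambda>x. c' x + pebble u x) (\<lambda>x. pebble u x + pebble u x)"
    using pebbling_relpow_add[OF m(2)] .
  ultimately have "(pebbling_step G ^^ (n + m)) (\<lambda>x. c x + c' x) (\<lambda>x. pebble u x + pebble u x)"
    by (auto simp: relpowp_add)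
  moreover have "pebbling_step G (\<lambda>x. pebble u x + pebble u x) (pebble w)"
    unfolding pebbling_step_def using adj adj_neq[OF adj]
    by (intro exI[of _ u] exI[of _ w]) (auto simp: pebble_def)
  ultimately have "(pebbling_step G ^^ Suc (n + m)) (\<lambda>x. c x + c' x) (pebble w)"
    by (blast intro: relpowp_Suc_I)
  then show ?thesis using n(1) m(1) by (auto simp: collects_def conf_size_add)
qed

text \<open>The equal sizes make the pieces a partition of \<open>C\<close> on
  \<open>verts G\<close>; the pointwise inequality also keeps them below \<open>C\<close> outside,
  so that the rest can be written as a difference.\<close>

definition pieces :: "'a \<Rightarrow> ('a \<Rightarrow> nat) \<Rightarrow> (('a \<Rightarrow> nat) \<times> 'a) list \<Rightarrow> bool" where
  "pieces r C ps \<longleftrightarrow>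
     (\<forall>(c, u) \<in> set ps. u \<in> verts G \<and> collects G c u \<and> conf_size G c \<le> 2 ^ ht r u) \<and>
     (\<forall>x. (\<Sum>p\<leftarrow>ps. fst p x) \<le> C x) \<and>
     (\<Sum>p\<leftarrow>ps. conf_size G (fst p)) = conf_size G C"

lemma pieces_exist: "\<exists>ps. pieces r C ps"
proof (induction "conf_size G C" arbitrary: C)
  case 0
  then have "pieces r C []" by (simp add: pieces_def)
  then show ?case by blast
next
  case (Suc n)
  obtain v where v: "v \<in> verts G" "C v > 0"
    using Suc.hyps(2) unfolding conf_size_def by (metis Zero_not_Suc gr0I sum.neutral)
  define C' where "C' = C(v := C v - 1)"
  have C: "C = (\<lambda>x. pebble v x + C' x)" using v by (auto simp: C'_def pebble_def)
  have size: "conf_size G C = Suc (conf_size G C')"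
    by (subst C) (simp add: conf_size_add conf_size_pebble v)
  then obtain ps where "pieces r C' ps" using Suc by force
  then have "pieces r C ((pebble v, v) # ps)"
    using v size collects_pebble conf_size_pebble by (simp add: pieces_def) (simp add: C)
  then show ?case by blast
qed

lemma pieces_perm: "pieces r C ps \<Longrightarrow> mset ps = mset qs \<Longrightarrow> pieces r C qs"
  unfolding pieces_def
  by (metis (no_types, lifting) mset_map set_mset_mset sum_mset_sum_list)

text \<open>The parent of \<open>u\<close> serves as \<open>w\<close>: its height is larger by at
  least one, which pays for the doubled size bound.\<close>

lemma pieces_merge:
  assumes r: "r \<in> verts G" and p: "pieces r C ((c, u) # (c', u) # ps)" and u: "u \<noteq> r"
  obtains w where "pieces r C ((\<lambda>x. c x + c' x, w) # ps)"
proof -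
  have uV: "u \<in> verts G" and c: "collects G c u" "conf_size G c \<le> 2 ^ ht r u"
    and c': "collects G c' u" "conf_size G c' \<le> 2 ^ ht r u"
    using p by (auto simp: pieces_def)
  obtain n where n: "gdist r u = Suc n" using gdist_eq_0_iff[OF r uV] u by (cases "gdist r u") auto
  obtain w where w: "w \<rightarrow> u" "gdist r w = n" using gdist_pred[OF r uV n] .
  have "(2::nat) ^ Suc (ht r u) \<le> 2 ^ ht r w"
    using ht_child[OF r w(1)] w(2) n by (intro power_increasing) auto
  then have "conf_size G (\<lambda>x. c x + c' x) \<le> 2 ^ ht r w" using c(2) c'(2) by (simp add: conf_size_add)
  then have "pieces r C ((\<lambda>x. c x + c' x, w) # ps)"
    using p collects_merge[OF c(1) c'(1) adj_sym[OF w(1)]] w(1) adj_in_verts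
    by (auto simp: pieces_def conf_size_add add.assoc)
  then show thesis using that by blast
qed

text \<open>The vertices in \<open>L\<close> are empty with nothing below them, so they carry no
  piece and their terms leave the threshold.\<close>

lemma cheap_part:
  assumes r: "r \<in> verts G"
    and L: "\<And>w. w \<in> L \<Longrightarrow> C w = 0 \<and> ht r w = 0"
    and size: "(\<Sum>u\<in>verts G - {r} - L. 2 ^ ht r u) < conf_size G C"
  obtains c where "\<And>x. c x \<le> C x" "collects G c r" "conf_size G c \<le> 2 ^ ecc G r"
proof -
  \<comment> \<open>In a list of least length no two pieces can be merged, so no vertex other than
    \<open>r\<close> occurs twice.\<close>
  obtain ps where ps: "pieces r C ps" and min: "\<And>qs. pieces r C qs \<Longrightarrow> length ps \<le> length qs"
    using ex_has_least_nat[of "pieces r C" _ length] pieces_exist by metis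
  have piece: "u \<in> verts G" "collects G c u" "conf_size G c \<le> 2 ^ ht r u" if "(c, u) \<in> set ps" for c u
    using ps that by (auto simp: pieces_def)
  have le: "c x \<le> C x" if "(c, u) \<in> set ps" for c u x
  proof -
    have "fst (c, u) x \<le> (\<Sum>p\<leftarrow>ps. fst p x)"
      using that by (intro member_le_sum_list) force+
    then show ?thesis using ps by (auto simp: pieces_def intro: le_trans)
  qed
  have "\<exists>c. (c, r) \<in> set ps"
  proof (rule ccontr)
    assume none: "\<nexists>c. (c, r) \<in> set ps"
    have dist: "distinct (map snd ps)"
    proof (rule ccontr)
      assume "\<not> distinct (map snd ps)"
      then obtain xs ys zs u where "map snd ps = xs @ [u] @ ys @ [u] @ zs"
        using not_distinct_decomp by blast
      then obtain as p bs q cs where pq: "ps = as @ p # bs @ q # cs" "snd p = u" "snd q = u"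
        by (auto simp: map_eq_append_conv map_eq_Cons_conv Cons_eq_map_conv append_eq_map_conv)
      then obtain c c' where cc: "p = (c, u)" "q = (c', u)" by (cases p; cases q) auto
      have "mset ps = mset ((c, u) # (c', u) # as @ bs @ cs)" using pq cc by simp
      then have "pieces r C ((c, u) # (c', u) # as @ bs @ cs)" using pieces_perm ps by blast
      moreover have "u \<noteq> r" using none pq cc by auto
      ultimately obtain w where "pieces r C ((\<lambda>x. c x + c' x, w) # as @ bs @ cs)"
        using pieces_merge[OF r] by blast
      from min[OF this] show False using pq by simp
    qed
    have sub: "set (map snd ps) \<subseteq> verts G - {r} - L"
    proof
      fix u assume "u \<in> set (map snd ps)"
      then obtain c where cu: "(c, u) \<in> set ps" by auto
      have "u \<notin> L"
      proof
        assume "u \<in> L"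
        then have h: "ht r u = 0" "C u = 0" using L by auto
        \<comment> \<open>A piece of size at most \<open>2 ^ 0\<close> takes no step, so it is a
          pebble already lying on \<open>u\<close>.\<close>
        then have "c = pebble u" using piece[OF cu] by (auto simp: collects_def)
        then show False using le[OF cu, of u] h by (simp add: pebble_def)
      qed
      then show "u \<in> verts G - {r} - L" using piece(1)[OF cu] none cu by auto
    qed
    have "conf_size G C = (\<Sum>p\<leftarrow>ps. conf_size G (fst p))" using ps by (simp add: pieces_def)
    also have "\<dots> \<le> (\<Sum>p\<leftarrow>ps. 2 ^ ht r (snd p))" using piece(3) by (intro sum_list_mono) auto
    also have "\<dots> = (\<Sum>u\<leftarrow>map snd ps. 2 ^ ht r u)" by (simp add: comp_def)
    also have "\<dots> = (\<Sum>u\<in>set (map snd ps). 2 ^ ht r u)"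
      by (rule sum_list_distinct_conv_sum_set[OF dist])
    also have "\<dots> \<le> (\<Sum>u\<in>verts G - {r} - L. 2 ^ ht r u)" using sub by (intro sum_mono2) auto
    finally show False using size by simp
  qed
  then obtain c where "(c, r) \<in> set ps" by blast
  then show thesis using that[of c] le piece ht_root[OF r] by metis
qed

end

section \<open>Unsolvable configurations\<close>

context tree_graph
begin

definition children :: "'a \<Rightarrow> 'a \<Rightarrow> 'a set" where
  "children r u = {x \<in> verts G. u \<rightarrow> x \<and> gdist r x = Suc (gdist r u)}"

text \<open>
  \<open>f u\<close> bounds the number of pebbles that the subtree of \<open>u\<close> can bring to \<open>u\<close>. The existence of such
  an \<open>f\<close> with a given value at the root is invariant under pebbling steps, and under replacing
  pebbles by twice as many on a child.
\<close>

definition capacity :: "'a \<Rightarrow> ('a \<Rightarrow> nat) \<Rightarrow> ('a \<Rightarrow> nat) \<Rightarrow> bool" where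
  "capacity r f C \<longleftrightarrow> (\<forall>u\<in>verts G. C u + (\<Sum>x\<in>children r u. f x div 2) \<le> f u)"

lemma finite_children [simp]: "finite (children r u)"
  by (simp add: children_def)

lemma child_neq: "x \<in> children r u \<Longrightarrow> x \<noteq> u"
  by (auto simp: children_def)

lemma root_not_child: "r \<in> verts G \<Longrightarrow> r \<notin> children r u"
  by (auto simp: children_def)

lemma parent_unique:
  assumes "r \<in> verts G" "x \<in> children r u" "x \<in> children r u'"
  shows "u = u'"
  using closer_neighbour_unique[OF assms(1), of x u u'] assms(2,3) adj_sym
  by (auto simp: children_def)

lemma sum_children_update:
  fixes f :: "'a \<Rightarrow> nat"
  assumes "r \<in> verts G" "x \<in> children r u"
  shows "(\<Sum>y\<in>children r u. (f(x := a)) y div 2) + f x div 2 = (\<Sum>y\<in>children r u. f y div 2) + a div 2"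
    and "z \<noteq> u \<Longrightarrow> (\<Sum>y\<in>children r z. (f(x := a)) y div 2) = (\<Sum>y\<in>children r z. f y div 2)"
proof -
  have "(\<Sum>y\<in>children r u - {x}. (f(x := a)) y div 2) = (\<Sum>y\<in>children r u - {x}. f y div 2)"
    by (intro sum.cong) auto
  then show "(\<Sum>y\<in>children r u. (f(x := a)) y div 2) + f x div 2
      = (\<Sum>y\<in>children r u. f y div 2) + a div 2"
    using assms(2) by (simp add: sum.remove)
  assume "z \<noteq> u"
  then have "x \<notin> children r z" using parent_unique[OF assms] by blast
  then show "(\<Sum>y\<in>children r z. (f(x := a)) y div 2) = (\<Sum>y\<in>children r z. f y div 2)"
    by (intro sum.cong) auto
qed

text \<open>A step towards \<open>r\<close> lowers \<open>f u\<close> by 2, hence its half by 1,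
  making room for the pebble that arrives on the parent. A step away raises \<open>f w\<close> by 1,
  hence its half by at most 1, covered by the two pebbles lost on \<open>u\<close>. The changed
  vertex is a child, so never \<open>r\<close>.\<close>

lemma capacity_step:
  assumes r: "r \<in> verts G" and f: "capacity r f C" and step: "pebbling_step G C C'"
  obtains f' where "capacity r f' C'" "f' r = f r"
proof -
  obtain u w where uw: "u \<rightarrow> w" "2 \<le> C u" "C' = C(u := C u - 2, w := C w + 1)"
    using step by (auto simp: pebbling_step_def)
  have V: "u \<in> verts G" "w \<in> verts G" using uw(1) adj_in_verts by auto
  have fC: "C z + (\<Sum>x\<in>children r z. f x div 2) \<le> f z" if "z \<in> verts G" for z
    using f that by (simp add: capacity_def)
  have neq: "u \<noteq> w" using adj_neq[OF uw(1)] .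
  from r uw(1) show thesis
  proof (cases rule: adj_gdist_cases)
    case 1
    then have ch: "u \<in> children r w" using V adj_sym[OF uw(1)] by (simp add: children_def)
    let ?f = "f(u := f u - 2)"
    have fu: "2 \<le> f u" using fC[OF V(1)] uw(2) by simp
    then have "(f u - 2) div 2 + 1 = f u div 2" by (simp add: div_add_self2 le_div_geq)
    then have w: "(\<Sum>x\<in>children r w. ?f x div 2) + 1 = (\<Sum>x\<in>children r w. f x div 2)"
      using sum_children_update(1)[OF r ch, of f "f u - 2"] by simp
    have "C' z + (\<Sum>x\<in>children r z. ?f x div 2) \<le> ?f z" if z: "z \<in> verts G" for z
    proof (cases "z = w")
      case True
      then show ?thesis using w fC[OF z] neq uw(3) by simp
    next
      case False
      then show ?thesis
        using fC[OF z] uw(2,3) sum_children_update(2)[OF r ch False, of f "f u - 2"] by auto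
    qed
    then have "capacity r ?f C'" by (simp add: capacity_def)
    moreover have "?f r = f r" using root_not_child[OF r] ch by auto
    ultimately show thesis using that by blast
  next
    case 2
    then have ch: "w \<in> children r u" using V uw(1) by (simp add: children_def)
    let ?f = "f(w := f w + 1)"
    have "(f w + 1) div 2 \<le> f w div 2 + 1" by simp
    then have u: "(\<Sum>x\<in>children r u. ?f x div 2) \<le> (\<Sum>x\<in>children r u. f x div 2) + 1"
      using sum_children_update(1)[OF r ch, of f "f w + 1"] by linarith
    have "C' z + (\<Sum>x\<in>children r z. ?f x div 2) \<le> ?f z" if z: "z \<in> verts G" for z
    proof (cases "z = u")
      case True
      then show ?thesis using u fC[OF z] neq uw(2,3) by simp
    next
      case False
      then show ?thesis
        using fC[OF z] uw(3) sum_children_update(2)[OF r ch False, of f "f w + 1"] by auto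
    qed
    then have "capacity r ?f C'" by (simp add: capacity_def)
    moreover have "?f r = f r" using root_not_child[OF r] ch by auto
    ultimately show thesis using that by blast
  qed
qed

lemma capacity_bound:
  assumes r: "r \<in> verts G" and f: "capacity r f C" and "(pebbling_step G)\<^sup>*\<^sup>* C C'"
  shows "C' r \<le> f r"
proof -
  from assms(3) have "\<exists>f'. capacity r f' C' \<and> f' r = f r"
  proof (induction rule: rtranclp_induct)
    case base
    then show ?case using f by blast
  next
    case (step C1 C2)
    then show ?case using capacity_step[OF r] by metis
  qed
  then show ?thesis using r by (fastforce simp: capacity_def)
qed

text \<open>Raising \<open>f l\<close> by \<open>2 * m\<close> raises its half by exactly
  \<open>m\<close>, the number of pebbles that \<open>y\<close> gives up.\<close>

lemma capacity_pull_child: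
  assumes r: "r \<in> verts G" and l: "l \<in> children r y"
    and f: "capacity r f (\<lambda>x. R x + (if x = y then m else 0))"
  shows "capacity r (f(l := f l + 2 * m)) (\<lambda>x. R x + (if x = l then 2 * m else 0))"
  unfolding capacity_def
proof
  fix z assume z: "z \<in> verts G"
  note fz = f[unfolded capacity_def, rule_format, OF z]
  show "R z + (if z = l then 2 * m else 0) + (\<Sum>x\<in>children r z. (f(l := f l + 2 * m)) x div 2)
      \<le> (f(l := f l + 2 * m)) z"
  proof (cases "z = y")
    case True
    then show ?thesis
      using fz sum_children_update(1)[OF r l, of f "f l + 2 * m"] child_neq[OF l] by simp
  next
    case False
    then show ?thesis
      using fz sum_children_update(2)[OF r l False, of f "f l + 2 * m"] by auto
  qed
qed

lemma capacity_pull: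
  assumes r: "r \<in> verts G" and u: "u \<in> verts G" and "l \<in> below r u"
    and f: "capacity r f (\<lambda>x. R x + (if x = u then m else 0))"
  shows "\<exists>f'. capacity r f' (\<lambda>x. R x + (if x = l then 2 ^ gdist u l * m else 0)) \<and> f' r = f r"
  using assms(3)
proof (induction "gdist u l" arbitrary: l)
  case 0
  then have "u = l" using gdist_eq_0_iff u by (auto simp: below_def)
  have eq: "2 ^ gdist u l * m = m" using 0(1) by simp
  show ?case unfolding eq using f \<open>u = l\<close> by auto
next
  case (Suc n)
  have l: "l \<in> verts G" "gdist r l = gdist r u + gdist u l" using Suc.prems by (auto simp: below_def)
  obtain y where y: "y \<rightarrow> l" "gdist u y = n" using gdist_pred[OF u l(1)] Suc.hyps(2) by metis
  have yV: "y \<in> verts G" using y(1) adj_in_verts by auto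
  have ry: "gdist r y = gdist r u + n"
    using gdist_triangle[OF r u yV] gdist_adj_le[OF r y(1)] y(2) l(2) Suc.hyps(2) by simp
  then have "y \<in> below r u" using yV y(2) by (simp add: below_def)
  from Suc.hyps(1)[OF y(2)[symmetric] this] obtain g where
    g: "capacity r g (\<lambda>x. R x + (if x = y then 2 ^ n * m else 0))" "g r = f r" using y(2) by auto
  have ch: "l \<in> children r y" using l y(1) ry Suc.hyps(2) by (simp add: children_def)
  have eq: "2 ^ gdist u l * m = 2 * (2 ^ n * m)" using Suc.hyps(2)[symmetric] by simp
  have "(g(l := g l + 2 * (2 ^ n * m))) r = f r"
    using g(2) root_not_child[OF r, of y] ch by auto
  then show ?case unfolding eq using capacity_pull_child[OF r ch g(1)] by blast
qed

lemma unsolvable_conf_exists: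
  assumes r: "r \<in> verts G"
  obtains C where "conf_size G C = weight r + k * 2 ^ ecc G r"
    "\<And>C'. (pebbling_step G)\<^sup>*\<^sup>* C C' \<Longrightarrow> C' r \<le> k"
proof -
  define m where "m = (\<lambda>u. if u = r then k else 1)"
  \<comment> \<open>\<open>S\<close> consists of the vertices whose initial pebbles have been pushed
    to a deepest vertex below them, and \<open>R\<close> of the pebbles they became; the other
    vertices still carry \<open>m\<close>.\<close>
  have "\<exists>R f. capacity r f (\<lambda>x. R x + (if x \<in> verts G - S then m x else 0)) \<and> f r = k \<and>
      conf_size G R = (\<Sum>u\<in>S. m u * 2 ^ ht r u)" if "S \<subseteq> verts G" for S
    using finite_subset[OF that finite_verts] that
  proof (induction S rule: finite_induct)
    case empty
    \<comment> \<open>Every child starts with a single pebble, and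
      \<open>1 div 2 = 0\<close>.\<close>
    have "(\<Sum>x\<in>children r u. m x div 2) = 0" for u
      using root_not_child[OF r, of u] by (intro sum.neutral) (auto simp: m_def)
    then have "capacity r m (\<lambda>x. 0 + (if x \<in> verts G - {} then m x else 0))"
      by (simp add: capacity_def)
    moreover have "m r = k" by (simp add: m_def)
    ultimately show ?case by (intro exI[of _ "\<lambda>_. 0"] exI[of _ m]) (simp add: conf_size_def)
  next
    case (insert u S)
    then obtain R f where f: "capacity r f (\<lambda>x. R x + (if x \<in> verts G - S then m x else 0))" "f r = k"
      and R: "conf_size G R = (\<Sum>u\<in>S. m u * 2 ^ ht r u)" by auto
    have u: "u \<in> verts G" using insert.prems by simp
    obtain l where l: "l \<in> below r u" "gdist u l = ht r u" using ht_attained[OF u] .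
    have lV: "l \<in> verts G" using l(1) below_subset by auto
    let ?D = "\<lambda>x. if x \<in> verts G - insert u S then m x else 0"
    have eq: "(\<lambda>x. R x + (if x \<in> verts G - S then m x else 0)) = (\<lambda>x. (R x + ?D x) + (if x = u then m u else 0))"
      using u insert.hyps(2) by auto
    obtain f' where f': "f' r = k"
      "capacity r f' (\<lambda>x. (R x + ?D x) + (if x = l then 2 ^ ht r u * m u else 0))"
      using capacity_pull[OF r u l(1) f(1)[unfolded eq]] f(2) unfolding l(2) by blast
    let ?R = "\<lambda>x. R x + (if x = l then 2 ^ ht r u * m u else 0)"
    have "(\<lambda>x. (R x + ?D x) + (if x = l then 2 ^ ht r u * m u else 0)) = (\<lambda>x. ?R x + ?D x)"
      by auto
    then have "capacity r f' (\<lambda>x. ?R x + ?D x)" using f'(2) by simp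
    moreover have "conf_size G ?R = (\<Sum>u\<in>insert u S. m u * 2 ^ ht r u)"
      using R lV insert.hyps by (simp add: conf_size_add) (simp add: conf_size_def)
    ultimately show ?case using f'(1) by (intro exI conjI)
  qed
  from this[of "verts G"] obtain R f where f: "capacity r f R" "f r = k"
    and R: "conf_size G R = (\<Sum>u\<in>verts G. m u * 2 ^ ht r u)" by auto
  have "(\<Sum>u\<in>verts G - {r}. m u * 2 ^ ht r u) = weight r"
    unfolding weight_def by (intro sum.cong) (auto simp: m_def)
  then have "conf_size G R = weight r + k * 2 ^ ecc G r"
    using R r by (simp add: sum.remove[of "verts G" r] ht_root m_def)
  then show thesis using that capacity_bound[OF r f(1)] f(2) by blast
qed

end

section \<open>Serving the targets\<close>

lemma conf_size_diff:
  "(\<And>x. c x \<le> C x) \<Longrightarrow> conf_size G (\<lambda>x. C x - c x) = conf_size G C - conf_size G c"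
  by (simp add: conf_size_def sum_subtractf_nat)

lemma collects_imp_rtranclp: "collects G c v \<Longrightarrow> (pebbling_step G)\<^sup>*\<^sup>* c (pebble v)"
  by (auto simp: collects_def intro: relpowp_imp_rtranclp)

text \<open>The part \<open>c\<close> delivers one pebble to \<open>v\<close>, which is then left
  alone while the remaining pebbles serve \<open>D'\<close>.\<close>

lemma target_solvable_peel:
  assumes c: "\<And>x. c x \<le> C x" "collects G c v"
    and D: "\<And>x. D x \<le> D' x + pebble v x" and sol: "target_solvable G D' (\<lambda>x. C x - c x)"
  shows "target_solvable G D C"
proof -
  let ?R = "\<lambda>x. C x - c x"
  obtain E where E: "(pebbling_step G)\<^sup>*\<^sup>* ?R E" "\<forall>v\<in>verts G. D' v \<le> E v"
    using sol by (auto simp: target_solvable_def)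
  have "(\<lambda>x. c x + ?R x) = C" using c(1) by auto
  then have "(pebbling_step G)\<^sup>*\<^sup>* C (\<lambda>x. ?R x + pebble v x)"
    using pebbling_rtranclp_add[OF collects_imp_rtranclp[OF c(2)], of ?R] by (simp add: add.commute)
  also have "(pebbling_step G)\<^sup>*\<^sup>* (\<lambda>x. ?R x + pebble v x) (\<lambda>x. E x + pebble v x)"
    using pebbling_rtranclp_add[OF E(1)] .
  finally have "(pebbling_step G)\<^sup>*\<^sup>* C (\<lambda>x. E x + pebble v x)" .
  moreover have "\<forall>x\<in>verts G. D x \<le> E x + pebble v x"
    using E(2) D by (meson add_le_mono1 le_trans)
  ultimately show ?thesis by (auto simp: target_solvable_def)
qed

lemma target_solvable_zero: "(\<And>x. x \<in> verts G \<Longrightarrow> D x = 0) \<Longrightarrow> target_solvable G D C"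
  by (auto simp: target_solvable_def)

lemma fold_solvable_mono:
  assumes "fold_solvable G t r C" "\<And>x. C x \<le> C' x"
  shows "fold_solvable G t r C'"
proof -
  obtain E where E: "(pebbling_step G)\<^sup>*\<^sup>* C E" "t \<le> E r" using assms(1) by (auto simp: fold_solvable_def)
  have "(\<lambda>x. C x + (C' x - C x)) = C'" using assms(2) by auto
  then show ?thesis
    using pebbling_rtranclp_add[OF E(1), of "\<lambda>x. C' x - C x"] E(2)
    by (auto simp: fold_solvable_def intro!: exI[of _ "\<lambda>x. E x + (C' x - C x)"])
qed

context fin_digraph
begin

lemma conf_size_decr:
  assumes "v \<in> verts G" "0 < C v"
  shows "conf_size G (C(v := C v - 1)) = conf_size G C - 1"
proof -
  have "C(v := C v - 1) = (\<lambda>x. C x - pebble v x)" by (auto simp: pebble_def)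
  moreover have "pebble v x \<le> C x" for x using assms(2) by (auto simp: pebble_def)
  ultimately show ?thesis using conf_size_diff[of "pebble v" C G] conf_size_pebble[OF assms(1)] by simp
qed

lemma conf_size_pos:
  assumes "0 < conf_size G C"
  obtains v where "v \<in> verts G" "0 < C v"
  using assms that unfolding conf_size_def by (metis gr0I less_numeral_extra(3) sum.neutral)

text \<open>\<open>rooted_pebbling_number\<close> speaks of one exact size, so a larger unsolvable
  configuration has to be cut down to it.\<close>

lemma subconf_exists:
  "m \<le> conf_size G C \<Longrightarrow> \<exists>C'. (\<forall>x. C' x \<le> C x) \<and> conf_size G C' = m"
proof (induction "conf_size G C - m" arbitrary: C)
  case 0
  then show ?case by (intro exI[of _ C]) auto
next
  case (Suc n)
  then have "0 < conf_size G C" by simp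
  then obtain v where v: "v \<in> verts G" "0 < C v" by (rule conf_size_pos)
  have "n = conf_size G (C(v := C v - 1)) - m" "m \<le> conf_size G (C(v := C v - 1))"
    using conf_size_decr[of v C, OF v] Suc.hyps(2) by auto
  then obtain C' where C': "\<forall>x. C' x \<le> (C(v := C v - 1)) x" "conf_size G C' = m"
    using Suc.hyps(1) by blast
  have "C' x \<le> C x" for x using C'(1)[rule_format, of x] by (auto split: if_splits)
  then show ?case using C'(2) by blast
qed

lemma support_size_le: "support_size G D \<le> conf_size G D"
proof -
  have "support_size G D = (\<Sum>v\<in>verts G. if 0 < D v then 1 else 0)"
    by (simp add: support_size_def sum.If_cases Int_def)
  also have "\<dots> \<le> conf_size G D" unfolding conf_size_def by (intro sum_mono) auto
  finally show ?thesis .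
qed

lemma support_size_decr_ge:
  assumes "v \<in> verts G"
  shows "support_size G D \<le> support_size G (D(v := D v - 1)) + 1"
proof -
  have "{x \<in> verts G. 0 < D x} \<subseteq> insert v {x \<in> verts G. 0 < (D(v := D v - 1)) x}" by auto
  then have "support_size G D \<le> card (insert v {x \<in> verts G. 0 < (D(v := D v - 1)) x})"
    unfolding support_size_def by (intro card_mono) auto
  also have "\<dots> \<le> support_size G (D(v := D v - 1)) + 1"
    unfolding support_size_def by (subst card_insert_if) auto
  finally show ?thesis .
qed

lemma support_size_decr_eq:
  assumes "2 \<le> D v"
  shows "support_size G (D(v := D v - 1)) = support_size G D"
proof -
  have "{x \<in> verts G. 0 < (D(v := D v - 1)) x} = {x \<in> verts G. 0 < D x}" using assms by auto
  then show ?thesis by (simp add: support_size_def)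
qed

end

context tree_graph
begin

lemma weight_remove_leaves:
  assumes "L \<subseteq> verts G - {v}" "\<And>w. w \<in> L \<Longrightarrow> ht v w = 0"
  shows "(\<Sum>u\<in>verts G - {v} - L. 2 ^ ht v u) + card L = weight v"
proof -
  have "weight v = (\<Sum>u\<in>verts G - {v} - L. 2 ^ ht v u) + (\<Sum>u\<in>L. 2 ^ ht v u)"
    unfolding weight_def using assms(1) by (intro sum.subset_diff) auto
  then show ?thesis using assms(2) by simp
qed

text \<open>\<open>K\<close> shrinks while \<open>L\<close> stays fixed: pebbles are only removed
  from \<open>C\<close>, so even served leaves remain empty in it, and each of the other leaves
  lowers the threshold at \<open>v\<close> by one. The summand \<open>2 ^ d\<close> on the right
  stands for \<open>card K - 1\<close> on the left.\<close>

lemma peripheral_target_solvable: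
  assumes L: "\<And>w. w \<in> L \<Longrightarrow> w \<in> verts G \<and> ecc G w = graph_diameter G"
    and B: "\<And>v. v \<in> verts G \<Longrightarrow> weight v \<le> B"
    and "finite K" "K \<subseteq> L" "\<And>w. w \<in> L \<Longrightarrow> C w = 0"
    and "B + 2 + card K * 2 ^ graph_diameter G \<le> conf_size G C + card L + 2 ^ graph_diameter G"
  shows "target_solvable G (\<lambda>x. if x \<in> K then 1 else 0) C"
  using assms(3-)
proof (induction K arbitrary: C rule: finite_induct)
  case empty
  then show ?case by (intro target_solvable_zero) simp
next
  case (insert v K)
  have fL: "finite L" using L by (meson finite_subset finite_verts subsetI)
  have v: "v \<in> L" "v \<in> verts G" "ecc G v = graph_diameter G" using insert.prems(1) L by auto
  have leaf: "ht v w = 0" if "w \<in> L - {v}" for w using ht_peripheral[OF v(2)] L that by auto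
  have "(\<Sum>u\<in>verts G - {v} - (L - {v}). 2 ^ ht v u) + card (L - {v}) = weight v"
    using L leaf by (intro weight_remove_leaves) auto
  moreover have "card L = Suc (card (L - {v}))" using fL v(1) by (metis card.remove)
  moreover have size: "B + 2 + card K * 2 ^ graph_diameter G \<le> conf_size G C + card L"
    using insert.prems(3) insert.hyps by simp
  ultimately have "(\<Sum>u\<in>verts G - {v} - (L - {v}). 2 ^ ht v u) < conf_size G C"
    using B[OF v(2)] by linarith
  then obtain c where c: "\<And>x. c x \<le> C x" "collects G c v" "conf_size G c \<le> 2 ^ ecc G v"
    using cheap_part[OF v(2), of "L - {v}" C] leaf insert.prems(2) by auto
  have "target_solvable G (\<lambda>x. if x \<in> K then 1 else 0) (\<lambda>x. C x - c x)"
  proof (rule insert.IH)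
    show "B + 2 + card K * 2 ^ graph_diameter G
        \<le> conf_size G (\<lambda>x. C x - c x) + card L + 2 ^ graph_diameter G"
      using size c(3) v(3) conf_size_diff[of c C G, OF c(1)] by simp
  qed (use insert.prems in auto)
  then show ?case using c(1,2) by (rule target_solvable_peel[rotated 3]) (auto simp: pebble_def)
qed

text \<open>Induction on the number of targets. Serving one frees \<open>2 ^ d\<close> in the size
  bound, but the bound rises by one if the support shrinks.\<close>

lemma target_solvable_large:
  assumes B: "\<And>v. v \<in> verts G \<Longrightarrow> weight v \<le> B"
    and "conf_size G D = Suc k"
    and "B + k * 2 ^ graph_diameter G + 2 \<le> conf_size G C + support_size G D"
  shows "target_solvable G D C"
  using assms(2,3)
proof (induction k arbitrary: C D)
  case 0
  obtain v where v: "v \<in> verts G" "0 < D v" using conf_size_pos[of D] 0 by auto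
  have "weight v < conf_size G C" using B[OF v(1)] 0 support_size_le[of D] by simp
  then obtain c where c: "\<And>x. c x \<le> C x" "collects G c v"
    using cheap_part[OF v(1), of "{}" C] by (auto simp: weight_def)
  let ?D = "D(v := D v - 1)"
  have "conf_size G ?D = 0" using conf_size_decr[of v D] v 0 by simp
  then have "target_solvable G ?D (\<lambda>x. C x - c x)"
    by (intro target_solvable_zero) (auto simp: conf_size_def)
  then show ?case using c by (rule target_solvable_peel[rotated 3]) (auto simp: pebble_def)
next
  case (Suc k)
  let ?d = "graph_diameter G"
  have "(k + 1) * 1 \<le> (k + 1) * 2 ^ ?d" by (intro mult_le_mono2) simp
  then have k: "k + 1 \<le> (k + 1) * 2 ^ ?d" "(k + 1) * 2 ^ ?d = k * 2 ^ ?d + 2 ^ ?d" by auto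
  \<comment> \<open>With \<open>support_size G D\<close> at most \<open>k + 2\<close>, the
    hypothesis exceeds \<open>B\<close>, so every vertex can be reached at cost
    \<open>2 ^ ecc\<close>.\<close>
  have large: "B < conf_size G C" using Suc.prems support_size_le[of D] k by simp
  \<comment> \<open>The induction hypothesis applies as soon as the saving below
    \<open>2 ^ d\<close> makes up for the loss of support.\<close>
  have peel: ?case
    if v: "v \<in> verts G" "0 < D v" and c: "\<And>x. c x \<le> C x" "collects G c v"
      and size: "conf_size G c + support_size G D \<le> 2 ^ ?d + support_size G (D(v := D v - 1))" for v c
  proof -
    have "conf_size G c \<le> conf_size G C" unfolding conf_size_def using c(1) by (intro sum_mono)
    then have "target_solvable G (D(v := D v - 1)) (\<lambda>x. C x - c x)"
      using Suc.prems size conf_size_decr[of v D] v k(2) conf_size_diff[of c C G, OF c(1)]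
      by (intro Suc.IH) (simp_all del: fun_upd_apply)
    then show ?thesis using c by (rule target_solvable_peel[rotated 3]) (auto simp: pebble_def)
  qed
  have cheap: "\<exists>c. (\<forall>x. c x \<le> C x) \<and> collects G c v \<and> conf_size G c \<le> 2 ^ ecc G v"
    if "v \<in> verts G" for v
    using cheap_part[OF that, of "{}" C] B[OF that] large by (auto simp: weight_def)
  show ?case
  proof (cases "\<exists>v\<in>verts G. 2 \<le> D v")
    case True
    then obtain v where v: "v \<in> verts G" "2 \<le> D v" by blast
    obtain c where c: "\<And>x. c x \<le> C x" "collects G c v" "conf_size G c \<le> 2 ^ ecc G v"
      using cheap[OF v(1)] by blast
    have "(2::nat) ^ ecc G v \<le> 2 ^ ?d" using ecc_le_diameter[OF v(1)] by simp
    then have "conf_size G c \<le> 2 ^ ?d" using c(3) by (rule le_trans[rotated])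
    then show ?thesis using peel[OF v(1) _ c(1,2)] support_size_decr_eq[of D v] v(2) by simp
  next
    case False
    then have D1: "D v = (if 0 < D v then 1 else 0)" if "v \<in> verts G" for v using that by force
    let ?L = "{v \<in> verts G. 0 < D v}"
    have "conf_size G D = (\<Sum>v\<in>verts G. if 0 < D v then 1 else 0)"
      unfolding conf_size_def using D1 by (intro sum.cong) auto
    also have "\<dots> = card ?L" by (simp add: sum.If_cases Int_def)
    finally have card: "card ?L = Suc (Suc k)" using Suc.prems(1) by simp
    \<comment> \<open>There are at least two distinct targets. A positive diameter makes both cost 1
      and cost \<open>2 ^ (d - 1)\<close> strictly less than \<open>2 ^ d\<close>.\<close>
    have "?d \<noteq> 0"
    proof
      assume "?d = 0"
      then have "x = y" if "x \<in> ?L" "y \<in> ?L" for x y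
        using gdist_le_diameter[of x y] gdist_eq_0_iff[of x y] that by auto
      then have "card ?L \<le> Suc 0" by (intro card_le_Suc0_iff_eq[THEN iffD2]) auto
      then show False using card by simp
    qed
    then obtain e where e: "?d = Suc e" by (cases ?d) auto
    show ?thesis
    proof (cases "\<exists>v\<in>?L. 0 < C v \<or> ecc G v < ?d")
      case True
      then obtain v where v: "v \<in> verts G" "0 < D v" "0 < C v \<or> ecc G v < ?d" by blast
      obtain c where c: "\<And>x. c x \<le> C x" "collects G c v" "conf_size G c + 1 \<le> 2 ^ ?d"
      proof (cases "0 < C v")
        case True
        have "(2::nat) ^ 1 \<le> 2 ^ ?d" using e by (intro power_increasing) auto
        then have "conf_size G (pebble v) + 1 \<le> 2 ^ ?d" using conf_size_pebble[OF v(1)] by simp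
        then show thesis
          using that[of "pebble v"] collects_pebble[OF v(1)] True by (simp add: pebble_def)
      next
        case False
        then have "ecc G v \<le> e" using v(3) e by simp
        then have "(2::nat) ^ ecc G v \<le> 2 ^ e" by simp
        moreover have "(2::nat) ^ e + 1 \<le> 2 ^ ?d" using e by simp
        moreover obtain c where c: "\<And>x. c x \<le> C x" "collects G c v" "conf_size G c \<le> 2 ^ ecc G v"
          using cheap[OF v(1)] by blast
        ultimately have "conf_size G c + 1 \<le> 2 ^ ?d" by linarith
        then show thesis using that c(1,2) by blast
      qed
      then show ?thesis using peel[OF v(1,2) c(1,2)] support_size_decr_ge[OF v(1), of D] by simp
    next
      case False
      have "target_solvable G (\<lambda>x. if x \<in> ?L then 1 else 0) C"
      proof (rule peripheral_target_solvable[of ?L B])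
        show "w \<in> verts G \<and> ecc G w = ?d" if "w \<in> ?L" for w
          using that False ecc_le_diameter[of w] by force
        show "B + 2 + card ?L * 2 ^ ?d \<le> conf_size G C + card ?L + 2 ^ ?d"
          using Suc.prems(2) card by (simp add: support_size_def)
      qed (use B False in auto)
      then obtain C' where C': "(pebbling_step G)\<^sup>*\<^sup>* C C'"
        "\<forall>v\<in>verts G. (if v \<in> ?L then 1 else 0) \<le> C' v" by (auto simp: target_solvable_def)
      have "D v \<le> C' v" if "v \<in> verts G" for v using C'(2) D1[OF that] that by force
      then show ?thesis using C'(1) by (auto simp: target_solvable_def)
    qed
  qed
qed

section \<open>Lower bound for the fold pebbling number\<close>

lemma max_weight_peripheral:
  obtains y where "y \<in> verts G" "ecc G y = graph_diameter G" "\<And>v. v \<in> verts G \<Longrightarrow> weight v \<le> weight y"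
proof -
  let ?P = "{y \<in> verts G. ecc G y = graph_diameter G}"
  have P: "finite ?P" "?P \<noteq> {}" using diameter_attained by auto
  then have "Max (weight ` ?P) \<in> weight ` ?P" by (intro Max_in) auto
  then obtain y where y: "Max (weight ` ?P) = weight y" "y \<in> ?P" by (rule imageE)
  have "weight v \<le> weight y" if v: "v \<in> verts G" for v
  proof (cases "ecc G v = graph_diameter G")
    case True
    then show ?thesis using v P(1) y(1)[symmetric] by simp
  next
    case False
    then show ?thesis using weight_le_peripheral[OF v] ecc_le_diameter[OF v] y(2) by simp
  qed
  then show thesis using that y(2) by blast
qed

lemma fold_pebbling_number_ge:
  assumes r: "r \<in> verts G"
  shows "weight r + k * 2 ^ ecc G r + 1 \<le> fold_pebbling_number G (Suc k)"
proof -
  let ?P = "\<lambda>m. \<forall>C. conf_size G C = m \<longrightarrow> fold_solvable G (Suc k) r C"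
  let ?D = "\<lambda>x. if x = r then Suc k else 0"
  obtain y where y: "\<And>v. v \<in> verts G \<Longrightarrow> weight v \<le> weight y" using max_weight_peripheral by blast
  have D: "conf_size G ?D = Suc k" using r by (simp add: conf_size_def)
  \<comment> \<open>The \<open>LEAST\<close> is meaningful only once some size works; placing all
    targets on \<open>r\<close> provides one.\<close>
  have "?P (weight y + k * 2 ^ graph_diameter G + 2)"
  proof (intro allI impI)
    fix C assume "conf_size G C = weight y + k * 2 ^ graph_diameter G + 2"
    then have "target_solvable G ?D C" using D y by (intro target_solvable_large) auto
    then obtain C' where "(pebbling_step G)\<^sup>*\<^sup>* C C'" "\<forall>v\<in>verts G. ?D v \<le> C' v"
      by (auto simp: target_solvable_def)
    moreover from this(2) r have "Suc k \<le> C' r" by force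
    ultimately show "fold_solvable G (Suc k) r C" unfolding fold_solvable_def by blast
  qed
  then have least: "?P (rooted_pebbling_number G (Suc k) r)"
    unfolding rooted_pebbling_number_def by (rule LeastI)
  obtain C where C: "conf_size G C = weight r + k * 2 ^ ecc G r"
    "\<And>C'. (pebbling_step G)\<^sup>*\<^sup>* C C' \<Longrightarrow> C' r \<le> k"
    using unsolvable_conf_exists[OF r, where k = k] by blast
  \<comment> \<open>Otherwise the unsolvable configuration would contain a solvable one of exactly
    the rooted pebbling number.\<close>
  have "weight r + k * 2 ^ ecc G r < rooted_pebbling_number G (Suc k) r"
  proof (rule ccontr)
    assume "\<not> ?thesis"
    then obtain C' where C': "\<forall>x. C' x \<le> C x" "conf_size G C' = rooted_pebbling_number G (Suc k) r"
      using subconf_exists[of "rooted_pebbling_number G (Suc k) r" C] C(1) by auto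
    then have "fold_solvable G (Suc k) r C" using least fold_solvable_mono[of G "Suc k" r C' C] by blast
    then show False using C(2) by (fastforce simp: fold_solvable_def)
  qed
  also have "\<dots> \<le> fold_pebbling_number G (Suc k)"
    unfolding fold_pebbling_number_def using r by (intro Max_ge) auto
  finally show ?thesis by simp
qed

text \<open>The part \<open>c\<close> produces the pebble on its own, its size is the cost, and the
  rest of \<open>C\<close> stays in place.\<close>

lemma solves_with_cost:
  assumes v: "v \<in> verts G" and size: "weight v < conf_size G C"
  shows "solves_with_cost_at_most G C v (2 ^ ecc G v)"
proof -
  obtain c where c: "\<And>x. c x \<le> C x" "collects G c v" "conf_size G c \<le> 2 ^ ecc G v"
    using cheap_part[OF v, of "{}" C] size by (auto simp: weight_def)
  obtain n where n: "conf_size G c = Suc n" "(pebbling_step G ^^ n) c (pebble v)"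
    using c(2) by (auto simp: collects_def)
  have "(\<lambda>x. c x + (C x - c x)) = C" using c(1) by auto
  then have "(pebbling_step G ^^ n) C (\<lambda>x. pebble v x + (C x - c x))"
    using pebbling_relpow_add[OF n(2), of "\<lambda>x. C x - c x"] by simp
  moreover have "1 \<le> pebble v v + (C v - c v)" by (simp add: pebble_def)
  moreover have "n + 1 \<le> 2 ^ ecc G v" using n(1) c(3) by simp
  ultimately show ?thesis unfolding solves_with_cost_at_most_def by blast
qed

end

theorem theorem4:
  fixes T :: "('a, 'b) pre_digraph" and D :: "'a \<Rightarrow> nat" and d t :: nat
  assumes "undirected_tree T"
    and "graph_diameter T = d"
    and "conf_size T D = t"
    and "t \<ge> 1"
  shows "int (target_pebbling_number T D)
           \<le> int (fold_pebbling_number T t) - int (support_size T D) + 1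
    \<and> (\<forall>C :: 'a \<Rightarrow> nat.
          int (conf_size T C) \<ge> int (fold_pebbling_number T t) - int (support_size T D) + 1
          \<longrightarrow> (\<forall>v\<in>verts T. D v > 0 \<longrightarrow> solves_with_cost_at_most T C v (2 ^ ecc T v)))"
proof -
  interpret graph T using assms(1) by (simp add: undirected_tree_def)
  interpret tree_graph T using assms(1) by unfold_locales
  obtain k where k: "t = Suc k" using assms(4) by (cases t) auto
  \<comment> \<open>Maximal weight makes \<open>weight y\<close> a valid bound for all targets;
    eccentricity \<open>d\<close> gives the lower bound at \<open>y\<close> its factor
    \<open>2 ^ d\<close>.\<close>
  obtain y where y: "y \<in> verts T" "ecc T y = graph_diameter T"
    "\<And>v. v \<in> verts T \<Longrightarrow> weight v \<le> weight y" using max_weight_peripheral by blast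
  let ?p = "fold_pebbling_number T t" and ?s = "support_size T D"
  have p: "weight y + k * 2 ^ graph_diameter T + 1 \<le> ?p"
    using fold_pebbling_number_ge[OF y(1), of k] y(2) k by simp
  have kd: "k \<le> k * 2 ^ graph_diameter T" by simp
  have s: "?s \<le> Suc k" using support_size_le[of D] assms(3) k by simp
  \<comment> \<open>This keeps the subtraction \<open>?p - ?s\<close> on naturals from being
    truncated.\<close>
  then have sp: "?s \<le> ?p" using kd p by linarith
  have "target_pebbling_number T D \<le> ?p - ?s + 1"
    unfolding target_pebbling_number_def
  proof (intro Least_le allI impI)
    fix C assume "?p - ?s + 1 \<le> conf_size T C"
    then have "weight y + k * 2 ^ graph_diameter T + 2 \<le> conf_size T C + ?s" using p sp by linarith
    then show "target_solvable T D C"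
      using target_solvable_large[OF y(3)] assms(3) k by blast
  qed
  then have "int (target_pebbling_number T D) \<le> int ?p - int ?s + 1" using sp by linarith
  moreover have "solves_with_cost_at_most T C v (2 ^ ecc T v)"
    if "int ?p - int ?s + 1 \<le> int (conf_size T C)" "v \<in> verts T" for C v
  proof -
    \<comment> \<open>The size is at least \<open>weight y + k * 2 ^ d + 2 - (k + 1)\<close>, and
      \<open>k \<le> k * 2 ^ d\<close> leaves one pebble more than \<open>weight y\<close>.\<close>
    have "weight y < conf_size T C" using that(1) p s kd by linarith
    then show ?thesis using solves_with_cost[OF that(2)] y(3)[OF that(2)] by simp
  qed
  ultimately show ?thesis by blast
qed

end
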